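(* Let $n$ and $M$ be positive integers, and let $A$ be an $n\times n$ matrix with Gaussian integer entries satisfying $|A_{k,l}|<M$ for all $k,l\in\{1,\ldots,n\}$. Let $\alpha=[\alpha_1\ \ldots\ \alpha_n]$ be a row vector of positive integers, put $\alpha_T=\sum_{k=1}^n\alpha_k$, and suppose that $x=[1\ \ldots\ 1]^T$ is the unique solution of $\alpha x=\alpha_T$ in the set $$R_B=\left\{[\beta_1\ \ldots\ \beta_n]^T:\ \beta_i\in\{0,\ldots,n\}\ \text{for all } i\in\{1,\ldots,n\},\ \sum_{i=1}^n\beta_i=n\right\}.$$ Let $z$ be a positive integer with $z>2(Mn)^n$, and define $$\mathrm{per}_m^A(z,\alpha)=\left[\frac{1}{z^{\alpha_T}}\prod_{i=1}^n\sum_{k=1}^n A_{i,k}z^{\alpha_k}\right],$$ where $[\,\cdot\,]$ denotes rounding to the nearest (Gaussian) integer. Then $$\mathrm{per}(A)\equiv \mathrm{per}_m^A(z,\alpha)\pmod z .$$ Moreover, if $a+b\mathrm{j}$ with $a,b\in\{0,\ldots,z-1\}$ denotes the least residue of $\mathrm{per}_m^A(z,\alpha)$ modulo $z$, then $$\mathrm{per}(A)=a+b\mathrm{j}-z\left(\mathrm{I}_{a>M^n n!}+\mathrm{j}\,\mathrm{I}_{b>M^n n!}\right).$$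
   Context: For an $n\times n$ complex matrix $A$, the permanent is $\mathrm{per}(A)=\sum_{\sigma\in S_n}\prod_{i=1}^n A_{i,\sigma_i}$, the sum being over all permutations $\sigma$ of $\{1,\ldots,n\}$. The imaginary unit is $\mathrm{j}$, with $\mathrm{j}^2=-1$. Gaussian integers are the numbers $u+v\mathrm{j}$ with $u,v\in\mathbb{Z}$. Rounding, congruence modulo $z$, and taking the least residue modulo $z$ are applied separately to the real and imaginary parts. $\mathrm{I}_{E}$ is the indicator, equal to $1$ if the condition $E$ holds and $0$ otherwise. *)

theory Defs
  imports "HOL-Analysis.Analysis" "HOL-Library.Real_Mod"
begin

definition permanent :: "'a::comm_ring_1 ^ 'n ^ 'n \<Rightarrow> 'a" where
  "permanent A = (\<Sum>\<sigma> | \<sigma> permutes (UNIV :: 'n set). \<Prod>i\<in>UNIV. A $ i $ \<sigma> i)"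

definition gaussian_ints :: "complex set" where
  "gaussian_ints = {w. \<exists>u v :: int. w = of_int u + of_int v * \<i>}"

(* Ties are rounded upwards, following the library function round. *)
definition gaussian_round :: "complex \<Rightarrow> complex" where
  "gaussian_round w = of_int (round (Re w)) + of_int (round (Im w)) * \<i>"

definition gaussian_cong :: "complex \<Rightarrow> complex \<Rightarrow> nat \<Rightarrow> bool" where
  "gaussian_cong v w z \<longleftrightarrow>
     [Re v = Re w] (rmod real z) \<and> [Im v = Im w] (rmod real z)"

definition gaussian_residue :: "complex \<Rightarrow> nat \<Rightarrow> complex" where
  "gaussian_residue w z = Complex (Re w rmod real z) (Im w rmod real z)"

definition row_times :: "nat ^ 'n \<Rightarrow> nat ^ 'n \<Rightarrow> nat" where
  "row_times \<alpha> x = (\<Sum>k\<in>UNIV. \<alpha> $ k * x $ k)"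

definition alpha_total :: "nat ^ 'n \<Rightarrow> nat" where
  "alpha_total \<alpha> = (\<Sum>k\<in>UNIV. \<alpha> $ k)"

definition R_B :: "(nat ^ 'n) set" where
  "R_B = {\<beta>. (\<forall>i. \<beta> $ i \<in> {0..CARD('n)}) \<and> (\<Sum>i\<in>UNIV. \<beta> $ i) = CARD('n)}"

definition per_m :: "complex ^ 'n ^ 'n \<Rightarrow> nat \<Rightarrow> nat ^ 'n \<Rightarrow> complex" where
  "per_m A z \<alpha> = gaussian_round
     (1 / of_nat z ^ alpha_total \<alpha> *
      (\<Prod>i\<in>UNIV. \<Sum>k\<in>UNIV. A $ i $ k * of_nat z ^ (\<alpha> $ k)))"

lemma per_m_gaussian: "per_m A z \<alpha> \<in> gaussian_ints"
  unfolding per_m_def gaussian_round_def gaussian_ints_def by blast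

lemma rmod_of_int: "of_int k rmod real z = of_int (k mod int z)"
proof (cases "z = 0")
  case False
  show ?thesis
  proof (rule rmod_unique)
    show "real_of_int (k mod int z) \<in> {0..<\<bar>real z\<bar>}"
    proof -
      have "0 \<le> k mod int z" "k mod int z < int z"
        using False by simp_all
      then have "0 \<le> real_of_int (k mod int z)" "real_of_int (k mod int z) < real_of_int (int z)"
        unfolding of_int_less_iff of_int_0_le_iff .
      then show ?thesis
        by simp
    qed
    show "real_of_int k = real_of_int (k mod int z) + real_of_int (k div int z) * real z"
      by (metis mod_mult_div_eq add.commute mult.commute of_int_add of_int_mult of_int_of_nat_eq)
  qed
qed simp

lemma gaussian_residue_ex1:
  assumes "w \<in> gaussian_ints" "z > 0"
  shows "\<exists>!(a, b). a \<in> {0..int z - 1} \<and> b \<in> {0..int z - 1} \<and>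
           of_int a + of_int b * \<i> = gaussian_residue w z"
proof -
  obtain u v :: int where "w = of_int u + of_int v * \<i>"
    using assms(1) by (auto simp: gaussian_ints_def)
  then have "gaussian_residue w z = of_int (u mod int z) + of_int (v mod int z) * \<i>"
    by (simp add: gaussian_residue_def rmod_of_int complex_eq_iff)
  then show ?thesis
    using assms(2) by (intro ex1I[of _ "(u mod int z, v mod int z)"]) (auto simp: complex_eq_iff)
qed

end

theory Submission
  imports Defs
begin

text \<open>Expanding the product over the rows gives one term for every choice function
  \<open>f\<close> of a column in each row, namely \<open>\<Prod>i. A $ i $ f i\<close> times \<open>z\<close> to the power
  \<open>e f = (\<Sum>i. \<alpha> $ f i)\<close>.  This exponent is \<open>\<alpha>\<close> applied to the vector counting how often
  \<open>f\<close> picks each column, and such count vectors lie in \<open>R_B\<close>.  The uniqueness hypothesis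
  therefore says that \<open>e f\<close> equals \<open>alpha_total \<alpha>\<close> exactly for the permutations \<open>f\<close>
  (lemma \<open>weight_eq_total_iff_permutes\<close>).

  After division by \<open>z ^ alpha_total \<alpha>\<close>, the permutations contribute the permanent, the
  larger exponents contribute a Gaussian integer multiple of \<open>z\<close>, and the smaller exponents
  contribute at most \<open>(M n)\<^sup>n / z\<close> in absolute value, because there are at most \<open>n\<^sup>n\<close> of
  them, each bounded by \<open>M\<^sup>n / z\<close>.  This is less than \<open>1 / 2\<close>, so rounding removes it (lemma \<open>per_m_eq_permanent_plus_multiple\<close>).  Finally the
  real and imaginary parts of the permanent are at most \<open>M\<^sup>n n!\<close> in absolute value, which
  is less than \<open>z / 2\<close>, so a residue above that bound is exactly one that comes from a
  negative number (lemma \<open>int_eq_mod_minus_shift\<close>).\<close>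

section \<open>Gaussian integers\<close>

lemma gaussian_ints_iff: "w \<in> gaussian_ints \<longleftrightarrow> Re w \<in> \<int> \<and> Im w \<in> \<int>"
proof
  assume "Re w \<in> \<int> \<and> Im w \<in> \<int>"
  then obtain u v :: int where "Re w = of_int u" "Im w = of_int v"
    by (auto elim!: Ints_cases)
  then have "w = of_int u + of_int v * \<i>"
    by (simp add: complex_eq_iff)
  then show "w \<in> gaussian_ints"
    unfolding gaussian_ints_def by blast
qed (auto simp: gaussian_ints_def)

lemma gaussian_ints_mult: "v \<in> gaussian_ints \<Longrightarrow> w \<in> gaussian_ints \<Longrightarrow> v * w \<in> gaussian_ints"
  by (simp add: gaussian_ints_iff)

lemma gaussian_ints_of_nat_power: "of_nat m ^ k \<in> gaussian_ints"
proof -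
  have "of_nat m ^ k = (of_nat (m ^ k) :: complex)"
    by simp
  then show ?thesis
    unfolding gaussian_ints_iff by (metis Ints_0 Ints_of_nat complex_Im_of_nat complex_Re_of_nat)
qed

lemma gaussian_ints_sum: "(\<And>x. x \<in> S \<Longrightarrow> f x \<in> gaussian_ints) \<Longrightarrow> sum f S \<in> gaussian_ints"
  by (auto simp: gaussian_ints_iff intro!: Ints_sum)

lemma gaussian_ints_prod: "(\<And>x. x \<in> S \<Longrightarrow> f x \<in> gaussian_ints) \<Longrightarrow> prod f S \<in> gaussian_ints"
  by (induction S rule: infinite_finite_induct) (simp_all add: gaussian_ints_iff)

text \<open>Both components of the perturbation are below \<open>1 / 2\<close>, so no ties occur.\<close>

lemma gaussian_round_perturbed:
  assumes "w \<in> gaussian_ints" and "cmod r < 1 / 2"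
  shows "gaussian_round (w + r) = w"
proof -
  obtain u v :: int where w: "w = of_int u + of_int v * \<i>"
    using assms(1) by (auto simp: gaussian_ints_def)
  have "\<bar>Re r\<bar> < 1 / 2" "\<bar>Im r\<bar> < 1 / 2"
    using assms(2) abs_Re_le_cmod[of r] abs_Im_le_cmod[of r] by linarith+
  then have "round (of_int u + Re r) = u" "round (of_int v + Im r) = v"
    by (auto intro!: round_unique')
  then show ?thesis
    by (simp add: gaussian_round_def w)
qed

section \<open>Exponents of the expanded product\<close>

lemma weight_eq_row_times_fibres:
  fixes \<alpha> :: "nat ^ 'n" and f :: "'n \<Rightarrow> 'n"
  shows "(\<Sum>i\<in>UNIV. \<alpha> $ f i) = row_times \<alpha> (\<chi> k. card {i. f i = k})"
proof -
  have "(\<Sum>i\<in>UNIV. \<alpha> $ f i) = (\<Sum>k\<in>UNIV. \<Sum>i | i \<in> UNIV \<and> f i = k. \<alpha> $ f i)"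
    by (rule sum.group[symmetric]) auto
  also have "\<dots> = (\<Sum>k\<in>UNIV. \<Sum>i | f i = k. \<alpha> $ k)"
    by (intro sum.cong) auto
  finally show ?thesis
    by (simp add: row_times_def mult.commute)
qed

lemma fibre_counts_in_R_B:
  fixes f :: "'n::finite \<Rightarrow> 'n"
  shows "(\<chi> k. card {i. f i = k}) \<in> R_B"
proof -
  have "(\<Sum>k\<in>UNIV. card {i. f i = k}) = (\<Sum>k\<in>UNIV. \<Sum>i | i \<in> UNIV \<and> f i = k. 1)"
    by simp
  also have "\<dots> = (\<Sum>i\<in>(UNIV :: 'n set). 1)"
    by (rule sum.group) auto
  finally show ?thesis
    by (auto simp: R_B_def intro: card_mono)
qed

text \<open>The all-ones count vector characterises the bijections, so uniqueness of the solution
  \<open>1\<close> turns an equation between exponents into bijectivity.\<close>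

lemma weight_eq_total_iff_permutes:
  fixes \<alpha> :: "nat ^ 'n"
  assumes unique: "{x \<in> R_B. row_times \<alpha> x = alpha_total \<alpha>} = {\<chi> i. 1}"
  shows "(\<Sum>i\<in>UNIV. \<alpha> $ f i) = alpha_total \<alpha> \<longleftrightarrow> f permutes UNIV"
proof
  assume "(\<Sum>i\<in>UNIV. \<alpha> $ f i) = alpha_total \<alpha>"
  then have "(\<chi> k. card {i. f i = k}) \<in> {x \<in> R_B. row_times \<alpha> x = alpha_total \<alpha>}"
    by (simp add: fibre_counts_in_R_B weight_eq_row_times_fibres)
  then have "card {i. f i = k} = 1" for k
    unfolding unique by (simp add: vec_eq_iff)
  then have "{i. f i = k} \<noteq> {}" for k
    by (metis card.empty zero_neq_one)
  then have "surj f"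
    unfolding surj_def by (metis (mono_tags, lifting) Collect_empty_eq)
  then have "bij f"
    by (simp add: bij_def finite_UNIV_surj_inj)
  then show "f permutes UNIV"
    by (intro bij_imp_permutes) simp_all
next
  assume "f permutes UNIV"
  then show "(\<Sum>i\<in>UNIV. \<alpha> $ f i) = alpha_total \<alpha>"
    unfolding alpha_total_def by (rule sum.permute[symmetric, unfolded o_def])
qed

section \<open>The rounded quotient and the permanent\<close>

lemma prod_row_sums_expand:
  fixes A :: "complex ^ 'n ^ 'n" and \<alpha> :: "nat ^ 'n"
  shows "(\<Prod>i\<in>UNIV. \<Sum>k\<in>UNIV. A $ i $ k * y ^ (\<alpha> $ k)) =
    (\<Sum>f\<in>UNIV. (\<Prod>i\<in>UNIV. A $ i $ f i) * y ^ (\<Sum>i\<in>UNIV. \<alpha> $ f i))"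
  by (subst prod_sum_PiE) (simp_all add: PiE_UNIV_domain prod.distrib power_sum)

lemma norm_prod_entries_le:
  fixes A :: "complex ^ 'n ^ 'n"
  assumes "\<And>k l. cmod (A $ k $ l) < real M"
  shows "cmod (\<Prod>i\<in>UNIV. A $ i $ f i) \<le> real M ^ CARD('n)"
  unfolding prod_norm[symmetric]
  using prod_mono[of UNIV "\<lambda>i. cmod (A $ i $ f i)" "\<lambda>_. real M"] assms
  by (simp add: less_imp_le)

text \<open>The terms \<open>t f\<close> of the expansion, already divided by \<open>z ^ T\<close>, are sorted by whether
  their exponent \<open>e f\<close> equals \<open>T\<close>, exceeds it (giving \<open>z * h\<close>) or falls short of it
  (giving the remainder \<open>r\<close>).\<close>

lemma per_m_eq_permanent_plus_multiple:
  fixes A :: "complex ^ 'n ^ 'n" and \<alpha> :: "nat ^ 'n"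
  assumes entries: "\<And>k l. A $ k $ l \<in> gaussian_ints"
    and bound: "\<And>k l. cmod (A $ k $ l) < real M"
    and unique: "{x \<in> R_B. row_times \<alpha> x = alpha_total \<alpha>} = {\<chi> i. 1}"
    and z: "z > 2 * (M * CARD('n)) ^ CARD('n)"
  obtains h where "h \<in> gaussian_ints" and "per_m A z \<alpha> = permanent A + of_nat z * h"
proof -
  define T where "T = alpha_total \<alpha>"
  define e where "e f = (\<Sum>i\<in>UNIV. \<alpha> $ f i)" for f :: "'n \<Rightarrow> 'n"
  define c where "c f = (\<Prod>i\<in>UNIV. A $ i $ f i)" for f :: "'n \<Rightarrow> 'n"
  define t where "t f = c f * of_nat z ^ e f / of_nat z ^ T" for f :: "'n \<Rightarrow> 'n"
  define h where "h = (\<Sum>f | e f > T. c f * of_nat z ^ (e f - T - 1))"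
  define r where "r = (\<Sum>f | e f < T. t f)"
  have z0: "z > 0"
    using z by linarith
  have c_int: "c f \<in> gaussian_ints" for f
    by (simp add: c_def gaussian_ints_prod entries)
  have h_int: "h \<in> gaussian_ints"
    by (simp add: h_def gaussian_ints_sum gaussian_ints_mult c_int gaussian_ints_of_nat_power)
  have per_int: "permanent A \<in> gaussian_ints"
    by (simp add: permanent_def gaussian_ints_sum gaussian_ints_prod entries)
  have "(\<Sum>f\<in>UNIV. t f) = (\<Sum>f\<in>{f. e f = T} \<union> {f. e f > T} \<union> {f. e f < T}. t f)"
    by (rule sum.cong) auto
  also have "\<dots> = (\<Sum>f | e f = T. t f) + (\<Sum>f | e f > T. t f) + r"
    unfolding r_def by (subst sum.union_disjoint, auto)+
  also have "(\<Sum>f | e f = T. t f) = permanent A"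
    unfolding permanent_def
  proof (rule sum.cong)
    show "{f. e f = T} = {\<sigma>. \<sigma> permutes UNIV}"
      using weight_eq_total_iff_permutes[OF unique] by (auto simp: e_def T_def)
    fix f assume "f \<in> {\<sigma>. \<sigma> permutes (UNIV :: 'n set)}"
    then have "e f = T"
      using weight_eq_total_iff_permutes[OF unique] by (simp add: e_def T_def)
    then show "t f = (\<Prod>i\<in>UNIV. A $ i $ f i)"
      using z0 by (simp add: t_def c_def)
  qed
  also have "(\<Sum>f | e f > T. t f) = of_nat z * h"
    unfolding h_def sum_distrib_left
  proof (rule sum.cong)
    fix f assume "f \<in> {f. e f > T}"
    then have "e f = T + Suc (e f - T - 1)"
      by simp
    then have "of_nat z ^ e f = of_nat z ^ T * (of_nat z * (of_nat z :: complex) ^ (e f - T - 1))"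
      by (metis power_Suc power_add)
    then show "t f = of_nat z * (c f * of_nat z ^ (e f - T - 1))"
      using z0 by (simp add: t_def)
  qed simp
  finally have split: "(\<Sum>f\<in>UNIV. t f) = permanent A + of_nat z * h + r" .

  have t_small: "cmod (t f) \<le> real M ^ CARD('n) / real z" if "e f < T" for f
  proof -
    have "T = e f + Suc (T - e f - 1)"
      using that by simp
    then have "real z ^ T = real z ^ e f * (real z * real z ^ (T - e f - 1))"
      by (metis power_Suc power_add)
    moreover have "real z ^ (T - e f - 1) \<ge> 1"
      using z0 by (simp add: one_le_power)
    ultimately have "real z ^ e f * real z \<le> real z ^ T"
      using z0 by simp
    then have "real z ^ e f / real z ^ T \<le> 1 / real z"
      using z0 by (simp add: field_simps)
    then have "cmod (c f) * (real z ^ e f / real z ^ T) \<le> real M ^ CARD('n) * (1 / real z)"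
      by (intro mult_mono) (use norm_prod_entries_le[of A M f] bound in \<open>simp_all add: c_def\<close>)
    then show ?thesis
      by (simp add: t_def norm_mult norm_divide norm_power)
  qed
  have "cmod r \<le> (\<Sum>f | e f < T. real M ^ CARD('n) / real z)"
    unfolding r_def by (rule sum_norm_le) (use t_small in simp)
  also have "\<dots> \<le> (\<Sum>f\<in>(UNIV :: ('n \<Rightarrow> 'n) set). real M ^ CARD('n) / real z)"
    by (rule sum_mono2) auto
  also have "\<dots> = real ((M * CARD('n)) ^ CARD('n)) / real z"
    by (simp add: card_fun power_mult_distrib)
  also have "\<dots> < 1 / 2"
  proof -
    have "2 * real ((M * CARD('n)) ^ CARD('n)) < real z"
      using z by (metis of_nat_less_iff of_nat_mult of_nat_numeral)
    then show ?thesis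
      using z0 by (simp add: field_simps)
  qed
  finally have r_small: "cmod r < 1 / 2" .

  have "per_m A z \<alpha> = gaussian_round (\<Sum>f\<in>UNIV. t f)"
    by (simp add: per_m_def prod_row_sums_expand t_def c_def e_def T_def sum_divide_distrib)
  also have "\<dots> = permanent A + of_nat z * h"
    unfolding split
    by (rule gaussian_round_perturbed)
      (use per_int h_int r_small in \<open>simp_all add: gaussian_ints_iff\<close>)
  finally show ?thesis
    using h_int that by blast
qed

section \<open>Recovering the permanent from its residue\<close>

lemma norm_permanent_le:
  fixes A :: "complex ^ 'n ^ 'n"
  assumes "\<And>k l. cmod (A $ k $ l) < real M"
  shows "cmod (permanent A) \<le> real (M ^ CARD('n) * fact CARD('n))"
proof -
  have "cmod (permanent A) \<le> (\<Sum>\<sigma> | \<sigma> permutes (UNIV :: 'n set). real M ^ CARD('n))"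
    unfolding permanent_def by (rule sum_norm_le) (use norm_prod_entries_le assms in blast)
  also have "\<dots> = real (M ^ CARD('n) * fact CARD('n))"
    by (simp add: card_permutations)
  finally show ?thesis .
qed

text \<open>The nonnegative candidates \<open>0, \<dots>, B\<close> are their own residues, the negative ones
  have residues \<open>m - B, \<dots>, m - 1\<close>; the two ranges are disjoint because \<open>2 * B < m\<close>.\<close>

lemma int_eq_mod_minus_shift:
  fixes p m B :: int
  assumes "\<bar>p\<bar> \<le> B" and "2 * B < m"
  shows "p = p mod m - m * of_bool (p mod m > B)"
proof (cases "p \<ge> 0")
  case True
  then have "p mod m = p"
    using assms by simp
  then show ?thesis
    using True assms by simp
next
  case False
  then have "p mod m = p + m"
    using assms by (intro int_mod_pos_eq[of _ _ "-1"]) auto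
  then show ?thesis
    using assms by auto
qed

theorem theorem2:
  fixes A :: "complex ^ 'n ^ 'n" and \<alpha> :: "nat ^ 'n" and M z :: nat
  assumes "M > 0"
    and "\<And>k l. A $ k $ l \<in> gaussian_ints"
    and "\<And>k l. cmod (A $ k $ l) < real M"
    and "\<And>k. \<alpha> $ k > 0"
    and "{x \<in> R_B. row_times \<alpha> x = alpha_total \<alpha>} = {\<chi> i. 1}"
    and "z > 0"
    and "z > 2 * (M * CARD('n)) ^ CARD('n)"
  shows "gaussian_cong (permanent A) (per_m A z \<alpha>) z \<and>
    (\<forall>a \<in> {0..int z - 1}. \<forall>b \<in> {0..int z - 1}.
       of_int a + of_int b * \<i> = gaussian_residue (per_m A z \<alpha>) z \<longrightarrow>
       permanent A = of_int a + of_int b * \<i>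
         - of_nat z * (of_bool (a > int (M ^ CARD('n) * fact CARD('n)))
                       + \<i> * of_bool (b > int (M ^ CARD('n) * fact CARD('n)))))"
proof -
  define B where "B = M ^ CARD('n) * fact CARD('n)"
  obtain h where "h \<in> gaussian_ints" and per_m: "per_m A z \<alpha> = permanent A + of_nat z * h"
    using per_m_eq_permanent_plus_multiple[OF assms(2,3,5,7)] .
  then obtain u v :: int where h: "h = of_int u + of_int v * \<i>"
    by (auto simp: gaussian_ints_def)
  have "permanent A \<in> gaussian_ints"
    by (simp add: permanent_def gaussian_ints_sum gaussian_ints_prod assms(2))
  then obtain p q :: int where per: "permanent A = of_int p + of_int q * \<i>"
    by (auto simp: gaussian_ints_def)
  have Re_m: "Re (per_m A z \<alpha>) = of_int (p + int z * u)"
    and Im_m: "Im (per_m A z \<alpha>) = of_int (q + int z * v)"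
    by (simp_all add: per_m per h)
  have residue: "Re (per_m A z \<alpha>) rmod real z = of_int (p mod int z)"
    "Im (per_m A z \<alpha>) rmod real z = of_int (q mod int z)"
    unfolding Re_m Im_m rmod_of_int by simp_all
  have cong: "gaussian_cong (permanent A) (per_m A z \<alpha>) z"
    unfolding gaussian_cong_def rcong_def residue by (simp add: per rmod_of_int)

  have "cmod (permanent A) \<le> real B"
    using norm_permanent_le[OF assms(3)] by (simp add: B_def)
  then have "\<bar>real_of_int p\<bar> \<le> real B" "\<bar>real_of_int q\<bar> \<le> real B"
    using abs_Re_le_cmod[of "permanent A"] abs_Im_le_cmod[of "permanent A"] by (simp_all add: per)
  then have small: "\<bar>p\<bar> \<le> int B" "\<bar>q\<bar> \<le> int B"
    by linarith+
  have "B \<le> (M * CARD('n)) ^ CARD('n)"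
    unfolding B_def power_mult_distrib using fact_le_power[where n = "CARD('n)" and 'a = nat]
    by (intro mult_left_mono) simp_all
  then have wide: "2 * int B < int z"
    using assms(7) by linarith
  note pq = small[THEN int_eq_mod_minus_shift, OF wide]

  have "permanent A = of_int a + of_int b * \<i>
      - of_nat z * (of_bool (a > int B) + \<i> * of_bool (b > int B))"
    if "of_int a + of_int b * \<i> = gaussian_residue (per_m A z \<alpha>) z" for a b :: int
  proof -
    have "a = p mod int z" "b = q mod int z"
      using that by (simp_all add: gaussian_residue_def residue complex_eq_iff)
    then have "p = a - int z * of_bool (a > int B)" "q = b - int z * of_bool (b > int B)"
      using pq by simp_all
    then show ?thesis
      unfolding per by (simp add: complex_eq_iff)
  qed
  with cong show ?thesis
    unfolding B_def by blast
qed

end
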